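(* Let $n\ge 1$ and let $w_n\in S_{n+1}$ be the permutation given in one-line notation by $1\,(n+1)\,n\cdots 2$, i.e. $w_n(1)=1$ and $w_n(i)=n+3-i$ for $2\le i\le n+1$. Let $\mathfrak{S}_{w_n}(x_1,\dots,x_{n+1})$ be its Schubert polynomial and let $C_n(q)$ be the Carlitz-Riordan $q$-Catalan number. Then $$\mathfrak{S}_{w_n}(1,q,\dots,q^n)=q^{\binom{n}{3}}\,C_n(q),$$ where the left side denotes the substitution $x_i=q^{i-1}$ for $1\le i\le n+1$.
   Context: The Carlitz-Riordan $q$-Catalan numbers are the polynomials defined by $C_0(q)=1$ and $C_n(q)=\sum_{k=0}^{n-1}q^k C_{n-k-1}(q)C_k(q)$ for $n\ge1$. An rc-graph for a permutation $w\in S_m$ is a filling of the upper-left half of an $m\times m$ array, i.e. of the positions $(i,j)$ (row $i$ counted from the top, column $j$ counted from the left) with $i,j\ge1$ and $i+j\le m+1$, by cross pieces and elbow joints. A cross piece lets one strand pass straight through horizontally (left edge to right edge) and another straight through vertically (bottom edge to top edge). An elbow joint connects the left edge to the top edge and the bottom edge to the right edge. Every position on the anti-diagonal $i+j=m+1$ is an elbow joint, of which only the strand from the left edge to the top edge is used. The filling must satisfy: for each $i$, the strand entering at the left of row $i$ exits at the top of column $w(i)$; and no two strands cross more than once (equivalently, there are exactly $\ell(w)$ cross pieces, where $\ell(w)$ is the number of inversions of $w$). Let $\mathcal{RC}(w)$ be the set of rc-graphs for $w$ and, for $D\in\mathcal{RC}(w)$, let $C(D)$ be the set of positions $(i,j)$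 of cross pieces of $D$. The Schubert polynomial of $w\in S_m$ is (taking this formula as the definition) $$\mathfrak{S}_w(x_1,\dots,x_m)=\sum_{D\in\mathcal{RC}(w)}\ \prod_{(i,j)\in C(D)}x_i .$$ *)

theory Defs
  imports "HOL-Library.Poly_Mapping" "HOL-Computational_Algebra.Polynomial"
    "HOL-Combinatorics.Permutations"
begin

text \<open>Multivariate polynomials with integer coefficients in variables \<open>x\<^sub>0, x\<^sub>1, \<dots>\<close> are finitely
  supported maps from exponent vectors to coefficients; their ring structure is the convolution
  product of finitely supported maps.\<close>

type_synonym mpoly = "(nat \<Rightarrow>\<^sub>0 nat) \<Rightarrow>\<^sub>0 int"

definition mvar :: "nat \<Rightarrow> mpoly" where
  "mvar i = Poly_Mapping.single (Poly_Mapping.single i 1) 1"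

definition mpoly_subst :: "(nat \<Rightarrow> 'a::comm_ring_1) \<Rightarrow> mpoly \<Rightarrow> 'a" where
  "mpoly_subst f p =
     (\<Sum>a\<in>Poly_Mapping.keys p. of_int (Poly_Mapping.lookup p a) *
        (\<Prod>i\<in>Poly_Mapping.keys a. f i ^ Poly_Mapping.lookup a i))"


definition positions :: "nat \<Rightarrow> (nat \<times> nat) set" where
  "positions m = {(i, j). 1 \<le> i \<and> 1 \<le> j \<and> i + j \<le> m + 1}"

text \<open>A filling is represented by its set \<open>D\<close> of cross pieces; every other position is an elbow
  joint. A strand is traced through the edges of the cells. \<open>LeftEdge i j\<close> and \<open>BottomEdge i j\<close> are
  the left and bottom edge of the cell \<open>(i, j)\<close>; its right edge is \<open>LeftEdge i (j + 1)\<close> and its top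
  edge is \<open>BottomEdge (i - 1) j\<close>. In particular \<open>BottomEdge 0 j\<close> is the top of column \<open>j\<close>.\<close>

datatype edge = LeftEdge nat nat | BottomEdge nat nat

inductive strand_step :: "nat \<Rightarrow> (nat \<times> nat) set \<Rightarrow> edge \<Rightarrow> edge \<Rightarrow> bool"
  for m :: nat and D :: "(nat \<times> nat) set"
where
  cross_left_right: "(i, j) \<in> positions m \<Longrightarrow> (i, j) \<in> D \<Longrightarrow>
     strand_step m D (LeftEdge i j) (LeftEdge i (j + 1))"
| cross_bottom_top: "(i, j) \<in> positions m \<Longrightarrow> (i, j) \<in> D \<Longrightarrow>
     strand_step m D (BottomEdge i j) (BottomEdge (i - 1) j)"
| elbow_left_top: "(i, j) \<in> positions m \<Longrightarrow> (i, j) \<notin> D \<Longrightarrow>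
     strand_step m D (LeftEdge i j) (BottomEdge (i - 1) j)"
| elbow_bottom_right: "(i, j) \<in> positions m \<Longrightarrow> (i, j) \<notin> D \<Longrightarrow>
     strand_step m D (BottomEdge i j) (LeftEdge i (j + 1))"

definition on_strand :: "nat \<Rightarrow> (nat \<times> nat) set \<Rightarrow> nat \<Rightarrow> edge \<Rightarrow> bool" where
  "on_strand m D p e \<longleftrightarrow> (strand_step m D)\<^sup>*\<^sup>* (LeftEdge p 1) e"

definition crossings :: "nat \<Rightarrow> (nat \<times> nat) set \<Rightarrow> nat \<Rightarrow> nat \<Rightarrow> (nat \<times> nat) set" where
  "crossings m D p r = {(i, j) \<in> D.
     on_strand m D p (LeftEdge i j) \<and> on_strand m D r (BottomEdge i j) \<or>
     on_strand m D r (LeftEdge i j) \<and> on_strand m D p (BottomEdge i j)}"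

text \<open>Requiring \<open>i + j \<le> m\<close> for cross pieces makes the anti-diagonal \<open>i + j = m + 1\<close> consist of
  elbow joints.\<close>

definition rc_graphs :: "nat \<Rightarrow> (nat \<Rightarrow> nat) \<Rightarrow> (nat \<times> nat) set set" where
  "rc_graphs m w = {D. D \<subseteq> {(i, j) \<in> positions m. i + j \<le> m} \<and>
     (\<forall>i\<in>{1..m}. on_strand m D i (BottomEdge 0 (w i))) \<and>
     (\<forall>p\<in>{1..m}. \<forall>r\<in>{1..m}. p \<noteq> r \<longrightarrow> card (crossings m D p r) \<le> 1)}"

definition schubert :: "nat \<Rightarrow> (nat \<Rightarrow> nat) \<Rightarrow> mpoly" where
  "schubert m w = (\<Sum>D\<in>rc_graphs m w. \<Prod>(i, j)\<in>D. mvar i)"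

text \<open>The set of rc-graphs and each rc-graph are finite, so neither the sum, the product, nor
  \<^const>\<open>card\<close> takes its default value.\<close>

lemma finite_positions: "finite (positions m)"
  by (rule finite_subset[of _ "{..m} \<times> {..m}"]) (auto simp: positions_def)

lemma finite_rc_graph: "D \<in> rc_graphs m w \<Longrightarrow> finite D"
  using finite_positions[of m] by (auto simp: rc_graphs_def intro: finite_subset)

lemma finite_rc_graphs: "finite (rc_graphs m w)"
  by (rule finite_subset[of _ "Pow (positions m)"]) (auto simp: rc_graphs_def finite_positions)


definition w_perm :: "nat \<Rightarrow> nat \<Rightarrow> nat" where
  "w_perm n i = (if 2 \<le> i \<and> i \<le> n + 1 then n + 3 - i else i)"

lemma w_perm_1: "w_perm n 1 = 1"
  by (simp add: w_perm_def)

lemma w_perm_permutes: "w_perm n permutes {1..n + 1}"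
proof (rule bij_imp_permutes)
  have "w_perm n (w_perm n i) = i" for i
    by (auto simp: w_perm_def)
  then show "bij_betw (w_perm n) {1..n + 1} {1..n + 1}"
    by (intro bij_betw_byWitness[where f' = "w_perm n"]) (auto simp: w_perm_def)
qed (auto simp: w_perm_def)


text \<open>The indeterminate \<open>q\<close> is the polynomial variable, so \<open>q\<^sup>k\<close> is \<^term>\<open>monom 1 k\<close>.\<close>

fun qcatalan :: "nat \<Rightarrow> int poly" where
  "qcatalan 0 = 1"
| "qcatalan (Suc n) = (\<Sum>k\<le>n. monom 1 k * qcatalan (n - k) * qcatalan k)"

end

theory Submission
  imports Defs
begin

text \<open>Read the cell \<open>(i, j)\<close> of the staircase as the chord from \<open>i\<close> to \<open>n + 3 - j\<close> of a polygon
  with vertices \<open>1, \<dots>, n + 2\<close>. The elbow joints of an rc-graph for \<open>w\<^sub>n\<close> then are the diagonals and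
  edges of a triangulation, and the strand entering in row \<open>b \<ge> 2\<close> turns exactly at the three sides
  of the triangle with middle vertex \<open>b\<close>. Indeed any two of the strands \<open>2, \<dots>, n + 1\<close> leave in
  inverted order, so there are at least \<open>n choose 2\<close> crosses and at most \<open>n\<close> elbow joints off the
  anti-diagonal; as each of these \<open>n\<close> strands must turn right at least once, it does so exactly once.
  Conversely, counting crosses shows that no two strands of a triangulation cross twice.
  Cutting a triangulation along the triangle on the side from \<open>1\<close> to \<open>n + 2\<close> gives the
  recursion of the Carlitz-Riordan polynomials.\<close>

section \<open>Binary trees and triangulations\<close>

datatype btree = Leaf | Node btree btree

text \<open>A tree with \<open>k\<close> nodes encodes a triangulation of the polygon with vertices
  \<open>a, \<dots>, a + k + 1\<close>; the edges of the polygon are included among the chords.\<close>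

fun chords :: "nat \<Rightarrow> btree \<Rightarrow> (nat \<times> nat) set" where
  "chords a Leaf = {(a, a + 1)}"
| "chords a (Node l r) =
     insert (a, a + size l + size r + 2) (chords a l \<union> chords (a + size l + 1) r)"

text \<open>The summand \<open>size l\<close> is the exponent of the factor \<open>q^k\<close> in
  the Carlitz-Riordan recursion, where \<open>k\<close> is the size of the left subtree.\<close>

fun left_weight :: "btree \<Rightarrow> nat" where
  "left_weight Leaf = 0"
| "left_weight (Node l r) = size l + left_weight l + left_weight r"

lemma chords_range: "(x, y) \<in> chords a t \<Longrightarrow> a \<le> x \<and> x < y \<and> y \<le> a + size t + 1"
  by (induction t arbitrary: a) fastforce+

lemma finite_chords: "finite (chords a t)"
  by (induction t arbitrary: a) auto

lemma chord_top: "(a, a + size t + 1) \<in> chords a t"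
  by (cases t) auto

lemma chord_edge: "a \<le> x \<Longrightarrow> x \<le> a + size t \<Longrightarrow> (x, Suc x) \<in> chords a t"
proof (induction t arbitrary: a)
  case (Node l r)
  then show ?case by (cases "x \<le> a + size l") auto
qed auto

text \<open>The chords of \<open>l\<close> and of \<open>r\<close> lie on different sides of the
  apex \<open>a + size l + 1\<close>, and the root chord spans them all, so a crossing could only
  occur within one subtree.\<close>

lemma chords_noncrossing:
  "(x, y) \<in> chords a t \<Longrightarrow> (x', y') \<in> chords a t \<Longrightarrow> \<not> (x < x' \<and> x' < y \<and> y < y')"
proof (induction t arbitrary: a)
  case (Node l r)
  show ?case
    using Node.prems Node.IH(1)[of a] Node.IH(2)[of "a + size l + 1"]
      chords_range[of x y a l] chords_range[of x' y' a l]
      chords_range[of x y "a + size l + 1" r] chords_range[of x' y' "a + size l + 1" r]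
    by auto
qed auto

text \<open>Descend to the node whose triangle has apex \<open>b\<close>: at a root with another
  apex, \<open>b\<close> lies strictly inside the range of one subtree.\<close>

lemma chords_triangle:
  assumes "a < b" "b < a + size t + 1"
  shows "\<exists>x y. x < b \<and> b < y \<and> (x, b) \<in> chords a t \<and> (b, y) \<in> chords a t \<and> (x, y) \<in> chords a t"
  using assms
proof (induction t arbitrary: a)
  case (Node l r)
  let ?b = "a + size l + 1"
  consider "b < ?b" | "b = ?b" | "b > ?b" by linarith
  then show ?case
  proof cases
    case 1
    then show ?thesis using Node.IH(1)[of a] Node.prems by auto
  next
    case 2
    have "(a, ?b) \<in> chords a l" using chord_top[of a l] by simp
    moreover have "(?b, ?b + size r + 1) \<in> chords ?b r" using chord_top[of ?b r] by simp
    ultimately show ?thesis using 2 by (intro exI[of _ a] exI[of _ "?b + size r + 1"]) auto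
  next
    case 3
    then show ?thesis using Node.IH(2)[of ?b] Node.prems by auto
  qed
qed auto

lemma chords_Node_disjoint:
  "chords a l \<inter> chords (a + size l + 1) r = {}"
  "(a, a + size l + size r + 2) \<notin> chords a l \<union> chords (a + size l + 1) r"
  using chords_range[of _ _ a l] chords_range[of _ _ "a + size l + 1" r] by fastforce+

lemma card_chords: "card (chords a t) = 2 * size t + 1"
proof (induction t arbitrary: a)
  case (Node l r)
  then show ?case
    using chords_Node_disjoint[of a l r] by (simp add: card_Un_disjoint finite_chords)
qed auto

text \<open>Relates the left endpoints of chords, which become row numbers, to the statistic on
  trees. The equation is additive because subtraction on \<open>nat\<close> truncates.\<close>

lemma sum_chords:
  "(\<Sum>(x, y)\<in>chords a t. x) + left_weight t = a * (2 * size t + 1) + size t ^ 2"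
proof (induction t arbitrary: a)
  case (Node l r)
  have "(\<Sum>(x, y)\<in>chords a (Node l r). x)
      = a + (\<Sum>(x, y)\<in>chords a l. x) + (\<Sum>(x, y)\<in>chords (a + size l + 1) r. x)"
    using chords_Node_disjoint[of a l r] by (simp add: sum.union_disjoint finite_chords)
  then have "(\<Sum>(x, y)\<in>chords a (Node l r). x) + left_weight (Node l r)
      = a + size l + (a * (2 * size l + 1) + size l ^ 2)
        + ((a + size l + 1) * (2 * size r + 1) + size r ^ 2)"
    using Node.IH(1)[of a] Node.IH(2)[of "a + size l + 1"] by simp
  then show ?case by (simp add: algebra_simps power2_eq_square)
qed auto

text \<open>The apex of the root triangle can be read off from the chord set, and the chords on
  either side of it then determine the two subtrees.\<close>

lemma chords_inject: "chords a t = chords a t' \<Longrightarrow> t = t'"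
proof (induction t arbitrary: a t')
  case Leaf
  then have "card (chords a t') = 1" by (metis card_chords btree.size(3) mult_0_right add_0)
  then show ?case by (cases t') (auto simp: card_chords simp del: chords.simps)
next
  case (Node l r)
  have "size t' = size (Node l r)"
    using card_chords[of a t'] card_chords[of a "Node l r"] Node.prems by simp
  then obtain l' r' where t': "t' = Node l' r'" and sz: "size l + size r = size l' + size r'"
    by (cases t') auto
  let ?b = "a + size l + 1" and ?b' = "a + size l' + 1" and ?c = "a + size l + size r + 2"
  let ?E = "chords a (Node l r)"
  have E': "?E = chords a (Node l' r')" using Node.prems t' by simp
  have 1: "(a, ?b) \<in> ?E" "(?b, ?c) \<in> ?E"
    using chord_top[of a l] chord_top[of ?b r] by (auto simp: add_ac)
  have 2: "(a, ?b') \<in> ?E" "(?b', ?c) \<in> ?E"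
    unfolding E' using chord_top[of a l'] chord_top[of ?b' r'] sz by (auto simp: add_ac)
  \<comment> \<open>If \<open>?b < ?b'\<close>, the chords \<open>(a, ?b')\<close> and
    \<open>(?b, ?c)\<close> would cross; symmetrically for \<open>?b' < ?b\<close>.\<close>
  have "?b = ?b'"
    using chords_noncrossing[OF 1(1) 2(2)] chords_noncrossing[OF 2(1) 1(2)]
      chords_noncrossing[OF 1(2) 2(1)] chords_noncrossing[OF 2(2) 1(1)] sz
    by linarith
  then have szl: "size l = size l'" and szr: "size r = size r'" using sz by simp_all
  have split: "chords a l = {(x, y) \<in> chords a (Node l r). y \<le> a + size l + 1}"
    "chords (a + size l + 1) r = {(x, y) \<in> chords a (Node l r). a + size l + 1 \<le> x}" for l r
    using chords_range[of _ _ a l] chords_range[of _ _ "a + size l + 1" r] by fastforce+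
  have "chords a l = chords a l'"
    unfolding split(1)[of l r] split(1)[of l' r'] E' szl ..
  moreover have "chords ?b r = chords ?b r'"
    using split(2)[of l r] split(2)[of l' r'] E' szl by metis
  ultimately show ?case using Node.IH t' by blast
qed

section \<open>Enumeration of trees by size\<close>

definition btrees :: "nat \<Rightarrow> btree set" where
  "btrees n = {t. size t = n}"

lemma btrees_0: "btrees 0 = {Leaf}"
proof -
  have "size t = 0 \<longleftrightarrow> t = Leaf" for t :: btree by (cases t) auto
  then show ?thesis by (auto simp: btrees_def)
qed

lemma btrees_Suc:
  "btrees (Suc n) = (\<lambda>(k, l, r). Node l r) ` (SIGMA k:{..n}. btrees k \<times> btrees (n - k))"
proof (intro equalityI subsetI)
  fix t assume "t \<in> btrees (Suc n)"
  then obtain l r where "t = Node l r" "size l + size r = n"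
    by (cases t) (auto simp: btrees_def)
  then show "t \<in> (\<lambda>(k, l, r). Node l r) ` (SIGMA k:{..n}. btrees k \<times> btrees (n - k))"
    by (intro image_eqI[of _ _ "(size l, l, r)"]) (auto simp: btrees_def)
qed (auto simp: btrees_def)

lemma finite_btrees: "finite (btrees n)"
proof (induction n rule: less_induct)
  case (less n)
  then show ?case
    by (cases n) (auto simp: btrees_0 btrees_Suc intro!: finite_imageI finite_SigmaI)
qed

text \<open>Splitting each tree at its root reproduces the recursion, with the size of the left
  subtree as its index.\<close>

lemma qcatalan_btrees: "qcatalan n = (\<Sum>t\<in>btrees n. monom 1 (left_weight t))"
proof (induction n rule: less_induct)
  case (less n)
  show ?case
  proof (cases n)
    case 0
    then show ?thesis by (simp add: btrees_0)
  next
    case (Suc k)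
    have "(\<Sum>t\<in>btrees n. monom (1::int) (left_weight t))
        = (\<Sum>(j, l, r)\<in>(SIGMA j:{..k}. btrees j \<times> btrees (k - j)). monom 1 (left_weight (Node l r)))"
      unfolding Suc btrees_Suc
      by (subst sum.reindex) (auto simp: inj_on_def btrees_def intro!: sum.cong)
    also have "\<dots> = (\<Sum>j\<le>k. \<Sum>l\<in>btrees j. \<Sum>r\<in>btrees (k - j). monom 1 (left_weight (Node l r)))"
      by (subst sum.Sigma[symmetric])
        (auto simp: finite_btrees sum.cartesian_product intro!: sum.cong)
    also have "\<dots> = (\<Sum>j\<le>k. \<Sum>l\<in>btrees j. \<Sum>r\<in>btrees (k - j).
        monom 1 j * (monom 1 (left_weight r) * monom 1 (left_weight l)))"
      by (intro sum.cong) (auto simp: btrees_def mult_monom add_ac)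
    also have "\<dots> = (\<Sum>j\<le>k. monom 1 j * qcatalan (k - j) * qcatalan j)"
    proof (intro sum.cong refl)
      fix j assume "j \<in> {..k}"
      then have "qcatalan (k - j) = (\<Sum>t\<in>btrees (k - j). monom 1 (left_weight t))"
        "qcatalan j = (\<Sum>t\<in>btrees j. monom 1 (left_weight t))"
        using less Suc by auto
      then show "(\<Sum>l\<in>btrees j. \<Sum>r\<in>btrees (k - j).
          monom 1 j * (monom 1 (left_weight r) * monom 1 (left_weight l)))
          = monom 1 j * qcatalan (k - j) * qcatalan j"
        by (simp add: sum_distrib_left sum_distrib_right mult.assoc)
    qed
    finally show ?thesis using Suc by simp
  qed
qed

section \<open>Counting positions\<close>

lemma positions_Suc:
  "positions (Suc m) = positions m \<union> (\<lambda>i. (i, m + 2 - i)) ` {1..m + 1}"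
  by (force simp: positions_def)

lemma sum_positions_Suc:
  "sum f (positions (Suc m)) = sum f (positions m) + (\<Sum>i=1..m + 1. f (i, m + 2 - i))"
proof -
  have "sum f ((\<lambda>i. (i, m + 2 - i)) ` {1..m + 1}) = (\<Sum>i=1..m + 1. f (i, m + 2 - i))"
    by (subst sum.reindex) (auto simp: inj_on_def)
  moreover have "positions m \<inter> (\<lambda>i. (i, m + 2 - i)) ` {1..m + 1} = {}"
    by (auto simp: positions_def)
  ultimately show ?thesis
    unfolding positions_Suc by (simp add: sum.union_disjoint finite_positions)
qed

lemma card_positions: "card (positions m) = (m + 1) choose 2"
proof (induction m)
  case 0
  have "positions 0 = {}" by (auto simp: positions_def)
  then show ?case by simp
next
  case (Suc m)
  then show ?case
    using sum_positions_Suc[of "\<lambda>_. 1::nat" m] by (simp add: numeral_2_eq_2)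
qed

lemma sum_diff_one: "(\<Sum>i=1..m. i - 1) = m choose 2"
  by (induction m) (auto simp: numeral_2_eq_2)

text \<open>The exponent of \<open>q\<close> if every cell were a cross. A new anti-diagonal adds
  \<open>(m + 1) choose 2\<close>, so Pascal's rule applies.\<close>

lemma sum_positions: "(\<Sum>(i, j)\<in>positions m. i - 1) = (m + 1) choose 3"
proof (induction m)
  case 0
  have "positions 0 = {}" by (auto simp: positions_def)
  then show ?case by simp
next
  case (Suc m)
  have "(\<Sum>i=1..m + 1. i - 1) = (m + 1) choose 2" by (rule sum_diff_one)
  with Suc show ?case
    by (simp add: sum_positions_Suc numeral_3_eq_3 numeral_2_eq_2 del: sum.cl_ivl_Suc)
qed

section \<open>Tracing strands\<close>

lemma strand_step_from:
  "strand_step m D (LeftEdge i j) e \<longleftrightarrow> (i, j) \<in> positions m \<and>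
     e = (if (i, j) \<in> D then LeftEdge i (j + 1) else BottomEdge (i - 1) j)"
  "strand_step m D (BottomEdge i j) e \<longleftrightarrow> (i, j) \<in> positions m \<and>
     e = (if (i, j) \<in> D then BottomEdge (i - 1) j else LeftEdge i (j + 1))"
  by (auto elim: strand_step.cases intro: strand_step.intros[simplified])

text \<open>\<open>LeftEdge i k\<close> is the right edge of the cell \<open>(i, k - 1)\<close> and
  \<open>BottomEdge k j\<close> the top edge of \<open>(k + 1, j)\<close>, so strands can be traced
  backwards too.\<close>

lemma strand_step_to:
  "strand_step m D e (LeftEdge i k) \<longleftrightarrow> k \<noteq> 0 \<and> (i, k - 1) \<in> positions m \<and>
     e = (if (i, k - 1) \<in> D then LeftEdge i (k - 1) else BottomEdge i (k - 1))"
  "strand_step m D e (BottomEdge k j) \<longleftrightarrow> (k + 1, j) \<in> positions m \<and>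
     e = (if (k + 1, j) \<in> D then BottomEdge (k + 1) j else LeftEdge (k + 1) j)"
  by (cases e; auto simp: strand_step_from positions_def)+

lemma strand_step_left_unique:
  "strand_step m D e1 e \<Longrightarrow> strand_step m D e2 e \<Longrightarrow> e1 = e2"
  by (cases e) (auto simp: strand_step_to)

lemma strand_step_right_unique:
  "strand_step m D e e1 \<Longrightarrow> strand_step m D e e2 \<Longrightarrow> e1 = e2"
  by (cases e) (auto simp: strand_step_from)

lemma no_step_to_start: "\<not> strand_step m D e (LeftEdge p 1)"
  by (simp add: strand_step_to positions_def)

lemma no_step_from_top: "\<not> strand_step m D (BottomEdge 0 j) e"
  by (auto simp: strand_step_from positions_def)

lemma on_strand_start: "on_strand m D p (LeftEdge p 1)"
  by (simp add: on_strand_def)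

lemma on_strand_step: "on_strand m D p e \<Longrightarrow> strand_step m D e e' \<Longrightarrow> on_strand m D p e'"
  by (simp add: on_strand_def)

lemma on_strand_induct [consumes 1, case_names start step]:
  assumes "on_strand m D p e" "P (LeftEdge p 1)"
    "\<And>e e'. on_strand m D p e \<Longrightarrow> strand_step m D e e' \<Longrightarrow> P e \<Longrightarrow> P e'"
  shows "P e"
  using assms unfolding on_strand_def by (rule rtranclp_induct)

lemma on_strand_cases:
  assumes "on_strand m D p e"
  obtains "e = LeftEdge p 1" | e' where "on_strand m D p e'" "strand_step m D e' e"
  using assms unfolding on_strand_def by (auto elim: rtranclp.cases)

text \<open>Strands that share an edge share its predecessors, and tracing back ends at an entry
  edge, which has no predecessor.\<close>

lemma origin_unique: "on_strand m D p e \<Longrightarrow> on_strand m D r e \<Longrightarrow> p = r"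
proof (induction rule: on_strand_induct)
  case start
  then show ?case using no_step_to_start by (auto elim: on_strand_cases)
next
  case (step e e')
  from step.prems show ?case
  proof (cases rule: on_strand_cases)
    case 1
    then show ?thesis using step no_step_to_start by blast
  next
    case (2 e'')
    then show ?thesis using step strand_step_left_unique by blast
  qed
qed

text \<open>Steps are deterministic and top edges are terminal, so from every edge of the strand the
  same exit is reached.\<close>

lemma exit_unique:
  assumes "on_strand m D p (BottomEdge 0 j)" "on_strand m D p (BottomEdge 0 k)"
  shows "j = k"
proof -
  have "(strand_step m D)\<^sup>*\<^sup>* e (BottomEdge 0 k)" if "on_strand m D p e" for e
    using that
  proof (induction rule: on_strand_induct)
    case start
    then show ?case using assms(2) by (simp add: on_strand_def)
  next
    case (step e e')
    from step.IH show ?case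
    proof (cases rule: converse_rtranclpE)
      case base
      then show ?thesis using step.hyps no_step_from_top by blast
    next
      case (step e'')
      then show ?thesis using \<open>strand_step m D e e'\<close> strand_step_right_unique by metis
    qed
  qed
  from this[OF assms(1)] show ?thesis
    using no_step_from_top by (auto elim: converse_rtranclpE)
qed

lemma strand_step_bounds:
  assumes "strand_step m D e e'"
  shows "case e' of LeftEdge i j \<Rightarrow> 1 \<le> i \<and> 1 \<le> j | BottomEdge i j \<Rightarrow> 1 \<le> j"
  using assms by cases (auto simp: positions_def)

lemma on_strand_bounds:
  assumes "on_strand m D p e" "1 \<le> p"
  shows "case e of LeftEdge i j \<Rightarrow> 1 \<le> i \<and> 1 \<le> j | BottomEdge i j \<Rightarrow> 1 \<le> j"
  using assms strand_step_bounds by (cases rule: on_strand_cases) auto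

section \<open>Straight runs and the next elbow joint\<close>

lemma row_run:
  assumes "on_strand m D p (LeftEdge i j)" "1 \<le> i" "1 \<le> j" "j \<le> k" "i + k \<le> m + 1"
    "\<And>s. j \<le> s \<Longrightarrow> s < k \<Longrightarrow> (i, s) \<in> D"
  shows "on_strand m D p (LeftEdge i k)"
  using assms(4-6)
proof (induction k rule: dec_induct)
  case base
  then show ?case using assms(1) by simp
next
  case (step k)
  then have "on_strand m D p (LeftEdge i k)" "(i, k) \<in> D" by auto
  moreover have "(i, k) \<in> positions m" using step assms by (auto simp: positions_def)
  ultimately show ?case by (auto simp: strand_step_from intro: on_strand_step)
qed

lemma column_run:
  assumes "on_strand m D p (BottomEdge i j)" "1 \<le> j" "k \<le> i" "i + j \<le> m + 1"
    "\<And>s. k < s \<Longrightarrow> s \<le> i \<Longrightarrow> (s, j) \<in> D"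
  shows "on_strand m D p (BottomEdge k j)"
  using assms(3,5)
proof (induction k rule: inc_induct)
  case base
  then show ?case using assms(1) by simp
next
  case (step k)
  then have "on_strand m D p (BottomEdge (Suc k) j)" "(Suc k, j) \<in> D" by auto
  moreover have "(Suc k, j) \<in> positions m" using step assms by (auto simp: positions_def)
  ultimately show ?case
    by (auto simp: strand_step_from intro: on_strand_step[of _ _ _ "BottomEdge (Suc k) j"])
qed

lemma turn_up:
  assumes "on_strand m D p (LeftEdge i j)" "(i, j) \<in> positions m" "(i, j) \<notin> D"
  shows "on_strand m D p (BottomEdge (i - 1) j)"
  using assms by (auto simp: strand_step_from intro: on_strand_step)

lemma turn_right:
  assumes "on_strand m D p (BottomEdge i j)" "(i, j) \<in> positions m" "(i, j) \<notin> D"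
  shows "on_strand m D p (LeftEdge i (j + 1))"
  using assms by (auto simp: strand_step_from intro: on_strand_step)

lemma next_elbow_in_row:
  assumes "D \<subseteq> positions n" "on_strand (n + 1) D p (LeftEdge i j)" "(i, j) \<in> positions (n + 1)"
  obtains t where "j \<le> t" "(i, t) \<in> positions (n + 1)" "(i, t) \<notin> D"
    "on_strand (n + 1) D p (BottomEdge (i - 1) t)"
proof -
  define t where "t = (LEAST t. j \<le> t \<and> (i, t) \<notin> D)"
  \<comment> \<open>Row \<open>i\<close> meets the anti-diagonal in column \<open>n + 2 - i\<close>;
    that cell is outside \<open>positions n\<close> and hence an elbow joint.\<close>
  have ex: "j \<le> n + 2 - i \<and> (i, n + 2 - i) \<notin> D"
    using assms by (auto simp: positions_def)
  have t: "j \<le> t" "(i, t) \<notin> D" "t \<le> n + 2 - i"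
    unfolding t_def using LeastI[of "\<lambda>t. j \<le> t \<and> (i, t) \<notin> D", OF ex] Least_le[of "\<lambda>t. j \<le> t \<and> (i, t) \<notin> D", OF ex]
    by auto
  have "(i, s) \<in> D" if "j \<le> s" "s < t" for s
    using not_less_Least[of s "\<lambda>t. j \<le> t \<and> (i, t) \<notin> D"] that t_def by auto
  then have "on_strand (n + 1) D p (LeftEdge i t)"
    using t assms by (intro row_run[OF assms(2)]) (auto simp: positions_def)
  moreover have "(i, t) \<in> positions (n + 1)" using t assms by (auto simp: positions_def)
  ultimately show ?thesis using that t turn_up by blast
qed

text \<open>A column may have no elbow joint on the way up, whence the first case. Rows count from
  the top, so the first elbow joint met is the one with the greatest row index.\<close>

lemma next_elbow_in_column:
  assumes "on_strand m D p (BottomEdge i j)" "1 \<le> j" "i + j \<le> m + 1"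
  obtains "on_strand m D p (BottomEdge 0 j)"
  | r where "1 \<le> r" "r \<le> i" "(r, j) \<notin> D" "on_strand m D p (BottomEdge r j)"
proof (cases "\<exists>r. 1 \<le> r \<and> r \<le> i \<and> (r, j) \<notin> D")
  case True
  define r where "r = (GREATEST r. 1 \<le> r \<and> r \<le> i \<and> (r, j) \<notin> D)"
  have r: "1 \<le> r \<and> r \<le> i \<and> (r, j) \<notin> D"
    unfolding r_def using True by (rule GreatestI_ex_nat[where b = i]) auto
  have "(s, j) \<in> D" if "r < s" "s \<le> i" for s
  proof (rule ccontr)
    assume "(s, j) \<notin> D"
    then have "s \<le> r" unfolding r_def using that by (intro Greatest_le_nat[where b = i]) auto
    then show False using that by simp
  qed
  then have "on_strand m D p (BottomEdge r j)"
    using column_run[OF assms(1,2)] r assms(3) by auto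
  then show ?thesis using that r by blast
next
  case False
  then have "on_strand m D p (BottomEdge 0 j)"
    using column_run[OF assms(1,2) _ assms(3), of 0] by force
  then show ?thesis using that by blast
qed

section \<open>Strands in inverted positions cross\<close>

text \<open>Every step increases \<open>level\<close> by one, so it serves as a common time for all strands; a cross
  exchanges the \<open>height\<close> of its two strands and an elbow joint preserves it.\<close>

fun level :: "edge \<Rightarrow> int" where
  "level (LeftEdge i j) = int j - int i"
| "level (BottomEdge i j) = int j - int i"

fun height :: "edge \<Rightarrow> nat" where
  "height (LeftEdge i j) = i + j"
| "height (BottomEdge i j) = i + j + 1"

lemma level_step: "strand_step m D e e' \<Longrightarrow> level e' = level e + 1"
  by (cases e) (auto simp: strand_step_from positions_def)

lemma level_ge_start: "on_strand m D p e \<Longrightarrow> 1 - int p \<le> level e"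
  by (induction rule: on_strand_induct) (auto simp: level_step)

lemma level_intermediate:
  assumes "on_strand m D p e" "1 - int p \<le> k" "k \<le> level e"
  obtains e' where "on_strand m D p e'" "level e' = k"
proof -
  have "\<exists>e'. on_strand m D p e' \<and> level e' = k"
    using assms(1,3)
  proof (induction rule: on_strand_induct)
    case start
    then show ?case using assms(2) on_strand_start by force
  next
    case (step e e')
    then show ?case
      using level_step[OF step.hyps(2)] on_strand_step[OF step.hyps]
      by (cases "k = level e'") auto
  qed
  then show ?thesis using that by blast
qed

text \<open>Cells on one diagonal occupy disjoint pairs of consecutive heights. Hence two strands
  can change their order only inside a common cell, and only if it is a cross.\<close>

lemma height_less_if_no_crossing:
  assumes "p < r" "1 \<le> p" "crossings m D p r = {}"
    "on_strand m D p e" "on_strand m D r e'" "level e = level e'"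
  shows "height e < height e'"
  using assms(4-6)
proof (induction arbitrary: e' rule: on_strand_induct)
  case start
  \<comment> \<open>The height \<open>p + 1\<close> at the entry of strand \<open>p\<close> is
    minimal for the level \<open>1 - p\<close>, and only \<open>LeftEdge p 1\<close> attains
    it.\<close>
  have "e' \<noteq> LeftEdge p 1"
    using origin_unique[OF start(1), of p] on_strand_start assms(1) by auto
  then show ?case
    using on_strand_bounds[OF start(1)] start(2) assms(1,2) by (cases e') auto
next
  case (step e f)
  have le: "level f = level e + 1" using step.hyps(2) by (rule level_step)
  from step.prems(1) show ?case
  proof (cases rule: on_strand_cases)
    case 1
    then have "level f = 1 - int r" using step.prems(2) by simp
    then show ?thesis using le level_ge_start[OF step.hyps(1)] assms(1) by simp
  next
    case (2 f')
    have lf: "level f' = level e" using level_step[OF 2(2)] step.prems(2) le by simp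
    have h: "height e < height f'" using step.IH[OF 2(1)] lf by simp
    have nc: "(i, j) \<notin> D" if "e = LeftEdge i j" "f' = BottomEdge i j" for i j
      using assms(3) step.hyps(1) 2(1) that by (auto simp: crossings_def)
    \<comment> \<open>On one diagonal the sums \<open>i + j\<close> all have the same
      parity.\<close>
    have gap: "(i, j) = (i', j') \<or> i + j + 2 \<le> i' + j' \<or> i' + j' + 2 \<le> i + j"
      if "int j - int i = int j' - int i'" for i j i' j'
      using that by auto
    obtain i j i' j' where "e = LeftEdge i j \<or> e = BottomEdge i j"
      "f' = LeftEdge i' j' \<or> f' = BottomEdge i' j'"
      by (metis edge.exhaust)
    then show ?thesis
      using gap[of j i j' i'] step.hyps(2) 2(2) h lf nc
      by (auto simp: strand_step_from positions_def split: if_splits)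
  qed
qed

text \<open>At level \<open>k\<close> strand \<open>r\<close> is at the top of column
  \<open>k\<close>, whose height \<open>k + 1\<close> is minimal for that level; without a crossing
  strand \<open>p\<close> would have to be strictly lower.\<close>

lemma crossings_nonempty:
  assumes "p < r" "1 \<le> p" "on_strand m D p (BottomEdge 0 j)" "on_strand m D r (BottomEdge 0 k)"
    "k < j"
  shows "crossings m D p r \<noteq> {}"
proof
  assume none: "crossings m D p r = {}"
  obtain e where e: "on_strand m D p e" "level e = int k"
    using level_intermediate[OF assms(3), of "int k"] assms by auto
  then have "height e < k + 1"
    using height_less_if_no_crossing[OF assms(1,2) none e(1) assms(4)] by simp
  then show False using on_strand_bounds[OF e(1) assms(2)] e(2) by (cases e) auto
qed

section \<open>Crossings of inverted pairs\<close>

definition "strand_pairs n = {(p, r). 2 \<le> p \<and> p < r \<and> r \<le> n + (1::nat)}"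

lemma finite_strand_pairs: "finite (strand_pairs n)"
  by (rule finite_subset[of _ "{..n + 1} \<times> {..n + 1}"]) (auto simp: strand_pairs_def)

text \<open>The pairs are the inversions of \<open>w_perm n\<close>, so this is its length.\<close>

lemma card_strand_pairs: "card (strand_pairs n) = n choose 2"
proof (cases n)
  case 0
  then have "strand_pairs n = {}" by (auto simp: strand_pairs_def)
  with 0 show ?thesis by simp
next
  case (Suc k)
  have "bij_betw (\<lambda>(p, r). (p - 1, r - p)) (strand_pairs n) (positions k)"
    by (rule bij_betw_byWitness[where f' = "\<lambda>(i, j). (i + 1, i + j + 1)"])
      (auto simp: strand_pairs_def positions_def Suc)
  then show ?thesis using card_positions[of k] Suc by (simp add: bij_betw_same_card)
qed

text \<open>A cross determines the two strands through it. As \<open>crossings\<close> is symmetric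
  in them, the order \<open>p < r\<close> makes the pair unique.\<close>

lemma crossings_disjoint:
  assumes "(p, r) \<in> strand_pairs n" "(p', r') \<in> strand_pairs n" "(p, r) \<noteq> (p', r')"
  shows "crossings m D p r \<inter> crossings m D p' r' = {}"
proof -
  have False if "(i, j) \<in> crossings m D p r" "(i, j) \<in> crossings m D p' r'" for i j
  proof -
    have "p = p' \<and> r = r' \<or> p = r' \<and> r = p'"
      using that by (auto simp: crossings_def dest: origin_unique)
    then show False using assms by (auto simp: strand_pairs_def)
  qed
  then show ?thesis by auto
qed

lemma sum_card_crossings_le:
  assumes "finite D"
  shows "(\<Sum>(p, r)\<in>strand_pairs n. card (crossings m D p r)) \<le> card D"
proof -
  have sub: "crossings m D p r \<subseteq> D" for p r by (auto simp: crossings_def)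
  have "(\<Sum>(p, r)\<in>strand_pairs n. card (crossings m D p r))
      = card (\<Union>(p, r)\<in>strand_pairs n. crossings m D p r)"
    using finite_strand_pairs crossings_disjoint[of _ _ n _ _ m D] finite_subset[OF sub assms]
    by (subst card_UN_disjoint) (simp_all add: split_beta prod_eq_iff)
  also have "\<dots> \<le> card D" using sub by (intro card_mono assms) auto
  finally show ?thesis .
qed

section \<open>From rc-graphs to triangulations\<close>

text \<open>The conditions on rc-graphs apart from the bound on crossings, which for triangulations
  is derived afterwards by counting. \<open>positions n\<close> is the staircase without its
  anti-diagonal.\<close>

definition connects :: "nat \<Rightarrow> (nat \<times> nat) set \<Rightarrow> bool" where
  "connects n D \<longleftrightarrow> D \<subseteq> positions n \<and>
     (\<forall>i\<in>{1..n + 1}. on_strand (n + 1) D i (BottomEdge 0 (w_perm n i)))"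

lemma rc_graphs_iff:
  "D \<in> rc_graphs (n + 1) (w_perm n) \<longleftrightarrow> connects n D \<and>
     (\<forall>p\<in>{1..n + 1}. \<forall>r\<in>{1..n + 1}. p \<noteq> r \<longrightarrow> card (crossings (n + 1) D p r) \<le> 1)"
proof -
  have "{(i, j) \<in> positions (n + 1). i + j \<le> n + 1} = positions n"
    by (auto simp: positions_def)
  then show ?thesis by (simp add: rc_graphs_def connects_def)
qed

lemma connects_exit:
  assumes "connects n D" "2 \<le> b" "b \<le> n + 1"
  shows "on_strand (n + 1) D b (BottomEdge 0 (n + 3 - b))"
proof -
  have "on_strand (n + 1) D b (BottomEdge 0 (w_perm n b))"
    using assms by (auto simp: connects_def)
  then show ?thesis using assms by (simp add: w_perm_def)
qed

lemma connects_finite: "connects n D \<Longrightarrow> finite D"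
  by (auto simp: connects_def intro: finite_subset[OF _ finite_positions])

lemma card_crossings_pos:
  assumes "connects n D" "(p, r) \<in> strand_pairs n"
  shows "1 \<le> card (crossings (n + 1) D p r)"
proof -
  have "crossings (n + 1) D p r \<noteq> {}"
    using assms(2) connects_exit[OF assms(1), of p] connects_exit[OF assms(1), of r]
    by (intro crossings_nonempty[of p r _ _ "n + 3 - p" "n + 3 - r"])
      (auto simp: strand_pairs_def)
  moreover have "finite (crossings (n + 1) D p r)"
    using connects_finite[OF assms(1)] by (rule rev_finite_subset) (auto simp: crossings_def)
  ultimately show ?thesis by (simp add: Suc_le_eq card_gt_0_iff)
qed

text \<open>Every inverted pair has a crossing, and different pairs cross in different
  cells.\<close>

lemma choose_2_le_card_connects:
  assumes "connects n D"
  shows "n choose 2 \<le> card D"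
proof -
  have "n choose 2 = (\<Sum>(p, r)\<in>strand_pairs n. 1)" by (simp add: card_strand_pairs)
  also have "\<dots> \<le> (\<Sum>(p, r)\<in>strand_pairs n. card (crossings (n + 1) D p r))"
    by (intro sum_mono) (use card_crossings_pos[OF assms] in auto)
  also have "\<dots> \<le> card D" by (rule sum_card_crossings_le[OF connects_finite[OF assms]])
  finally show ?thesis .
qed

section \<open>Right turns of the strands\<close>

definition right_turns :: "nat \<Rightarrow> (nat \<times> nat) set \<Rightarrow> nat \<Rightarrow> (nat \<times> nat) set" where
  "right_turns n D b = {(i, j) \<in> positions n - D. on_strand (n + 1) D b (BottomEdge i j)}"

text \<open>Strand \<open>b\<close> first turns up in a column \<open>t \<le> n + 2 - b\<close>,
  left of its exit column \<open>n + 3 - b\<close>, so it must turn right in column \<open>t\<close>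
  above row \<open>b\<close>.\<close>

lemma right_turn_exists:
  assumes "connects n D" "2 \<le> b" "b \<le> n + 1"
  obtains r t where "(r, t) \<in> right_turns n D b" "r < b" "(b, t) \<in> positions (n + 1)" "(b, t) \<notin> D"
proof -
  have D: "D \<subseteq> positions n" using assms by (auto simp: connects_def)
  have b1: "(b, 1) \<in> positions (n + 1)" using assms by (auto simp: positions_def)
  obtain t where t: "1 \<le> t" "(b, t) \<in> positions (n + 1)" "(b, t) \<notin> D"
    "on_strand (n + 1) D b (BottomEdge (b - 1) t)"
    by (rule next_elbow_in_row[OF D on_strand_start b1])
  have tb: "b - 1 + t \<le> n + 1 + 1" "b + t \<le> n + 2" using t(2) by (auto simp: positions_def)
  from t(4,1) tb(1) show ?thesis
  proof (cases rule: next_elbow_in_column)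
    case 1
    then have "t = n + 3 - b" using connects_exit[OF assms] exit_unique by blast
    then show ?thesis using tb(2) assms by simp
  next
    case (2 r)
    then show ?thesis
      using that[of r t] t tb assms by (auto simp: right_turns_def positions_def)
  qed
qed

text \<open>There are at most \<open>n\<close> elbow joints off the anti-diagonal, and each of the \<open>n\<close> strands
  \<open>2, \<dots>, n + 1\<close> turns right in at least one of them.\<close>

lemma right_turns_unique:
  assumes "connects n D" "(i, j) \<in> positions n - D"
  obtains b where "2 \<le> b" "b \<le> n + 1" "right_turns n D b = {(i, j)}"
proof -
  define rt where "rt b = (SOME c. c \<in> right_turns n D b)" for b
  have rt: "rt b \<in> right_turns n D b" if "b \<in> {2..n + 1}" for b
    using right_turn_exists[OF assms(1), of b] that unfolding rt_def
    by (metis atLeastAtMost_iff someI_ex)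
  have D: "D \<subseteq> positions n" using assms by (auto simp: connects_def)
  have disj: "b = b'" if "c \<in> right_turns n D b" "c \<in> right_turns n D b'" for b b' c
    using that by (auto simp: right_turns_def dest: origin_unique)
  have inj: "inj_on rt {2..n + 1}" by (rule inj_onI) (metis rt disj)
  have sub: "rt ` {2..n + 1} \<subseteq> positions n - D" using rt by (force simp: right_turns_def)
  have "card (positions n - D) = (n + 1 choose 2) - card D"
    using card_Diff_subset[OF connects_finite[OF assms(1)] D] by (simp add: card_positions)
  also have "\<dots> \<le> n" using choose_2_le_card_connects[OF assms(1)] by (simp add: numeral_2_eq_2)
  also have "n = card (rt ` {2..n + 1})" using inj by (simp add: card_image)
  finally have surj: "rt ` {2..n + 1} = positions n - D"
    using sub finite_positions by (intro card_seteq) auto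
  then obtain b where b: "b \<in> {2..n + 1}" "(i, j) = rt b" using assms(2) by (metis imageE)
  have "c = (i, j)" if "c \<in> right_turns n D b" for c
  proof -
    have "c \<in> positions n - D" using that by (auto simp: right_turns_def)
    then obtain b' where "b' \<in> {2..n + 1}" "c = rt b'" using surj by (metis imageE)
    then have "b' = b" using disj[of c b' b] rt[of b'] that by simp
    then show ?thesis using \<open>c = rt b'\<close> b(2) by simp
  qed
  moreover have "(i, j) \<in> right_turns n D b" using rt[OF b(1)] b(2) by simp
  ultimately have "right_turns n D b = {(i, j)}" by blast
  then show ?thesis using that b by auto
qed

text \<open>Strand \<open>b\<close> turns up at \<open>(b, j)\<close>, right at
  \<open>(i, j)\<close> and up again in row \<open>i\<close>; having no second right turn, it then
  runs straight to its exit column \<open>n + 3 - b\<close>. As chords, the three cells are the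
  sides of the triangle with vertices \<open>i\<close>, \<open>b\<close> and
  \<open>n + 3 - j\<close>.\<close>

lemma elbow_triangle:
  assumes "connects n D" "(i, j) \<in> positions n - D"
  obtains b where "i < b" "(b, j) \<in> positions (n + 1) - D" "(i, n + 3 - b) \<in> positions (n + 1) - D"
proof -
  obtain b where b: "2 \<le> b" "b \<le> n + 1" and rt: "right_turns n D b = {(i, j)}"
    using right_turns_unique[OF assms] .
  have D: "D \<subseteq> positions n" using assms by (auto simp: connects_def)
  have 1: "i < b" "(b, j) \<in> positions (n + 1)" "(b, j) \<notin> D"
    using right_turn_exists[OF assms(1) b] rt by auto
  have ij: "(i, j) \<in> positions (n + 1)" "(i, j + 1) \<in> positions (n + 1)" "(i, j) \<notin> D"
    using assms(2) by (auto simp: positions_def)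
  have "on_strand (n + 1) D b (BottomEdge i j)" using rt by (auto simp: right_turns_def)
  then have "on_strand (n + 1) D b (LeftEdge i (j + 1))" using ij turn_right by blast
  then obtain t where t: "j + 1 \<le> t" "(i, t) \<in> positions (n + 1)" "(i, t) \<notin> D"
    "on_strand (n + 1) D b (BottomEdge (i - 1) t)"
    using next_elbow_in_row[OF D _ ij(2)] by metis
  have ti: "1 \<le> t" "i - 1 + t \<le> n + 1 + 1" "1 \<le> i" "i + t \<le> n + 2"
    using t by (auto simp: positions_def)
  from t(4) ti(1,2) have "t = n + 3 - b"
  proof (cases rule: next_elbow_in_column)
    case 1
    then show ?thesis using connects_exit[OF assms(1) b] exit_unique by blast
  next
    case (2 r)
    then have "(r, t) \<in> right_turns n D b"
      using t ti by (auto simp: right_turns_def positions_def)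
    then show ?thesis using rt 2 ti by auto
  qed
  then show ?thesis using that 1 t by auto
qed

text \<open>The anti-diagonal \<open>i + j = n + 2\<close> corresponds to the polygon edges
  \<open>(x, x + 1)\<close>.\<close>

definition elbow_chords :: "nat \<Rightarrow> (nat \<times> nat) set \<Rightarrow> (nat \<times> nat) set" where
  "elbow_chords n D = {(x, y). 1 \<le> x \<and> x < y \<and> y \<le> n + 2 \<and> (x, n + 3 - y) \<notin> D}"

text \<open>A chord starts at the row number of its cell. A constant \<open>f\<close> counts
  crosses; \<open>i - 1\<close> yields the exponent of \<open>q\<close>.\<close>

lemma sum_elbow_chords:
  fixes f :: "nat \<Rightarrow> nat"
  assumes "D \<subseteq> positions n"
  shows "(\<Sum>(x, y)\<in>elbow_chords n D. f x) + (\<Sum>(i, j)\<in>D. f i) = (\<Sum>(i, j)\<in>positions (n + 1). f i)"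
proof -
  have D: "D \<subseteq> positions (n + 1)" using assms by (auto simp: positions_def)
  have "bij_betw (\<lambda>(x, y). (x, n + 3 - y)) (elbow_chords n D) (positions (n + 1) - D)"
    by (rule bij_betw_byWitness[where f' = "\<lambda>(x, y). (x, n + 3 - y)"])
      (auto simp: elbow_chords_def positions_def)
  then have "(\<Sum>(i, j)\<in>positions (n + 1) - D. f i) = (\<Sum>(x, y)\<in>elbow_chords n D. f x)"
    using sum.reindex_bij_betw[of _ _ _ "\<lambda>(i, j). f i"] by (fastforce simp: split_beta)
  then show ?thesis using sum.subset_diff[OF D finite_positions] by metis
qed

lemma card_elbow_chords:
  assumes "D \<subseteq> positions n"
  shows "card (elbow_chords n D) + card D = (n + 2) choose 2"
  using sum_elbow_chords[OF assms, of "\<lambda>_. 1"] by (simp add: card_positions)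

lemma choose_2_add_2: "(n + 2) choose 2 = (n choose 2) + 2 * n + 1"
  by (simp add: numeral_2_eq_2)

text \<open>For an elbow chord that is not an edge, \<open>elbow_triangle\<close> provides an apex
  \<open>b\<close> whose two sides are shorter elbow chords; recursion on them builds the
  tree.\<close>

lemma elbow_chords_contains_chords:
  assumes "connects n D" "(x, y) \<in> elbow_chords n D"
  shows "\<exists>t. x + size t + 1 = y \<and> chords x t \<subseteq> elbow_chords n D"
  using assms(2)
proof (induction "y - x" arbitrary: x y rule: less_induct)
  case less
  have xy: "1 \<le> x" "x < y" "y \<le> n + 2" "(x, n + 3 - y) \<notin> D"
    using less.prems by (auto simp: elbow_chords_def)
  show ?case
  proof (cases "y = x + 1")
    case True
    then show ?thesis using less.prems by (intro exI[of _ Leaf]) auto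
  next
    case False
    then have "(x, n + 3 - y) \<in> positions n - D" using xy by (auto simp: positions_def)
    then obtain b where b: "x < b" "(b, n + 3 - y) \<in> positions (n + 1) - D"
      "(x, n + 3 - b) \<in> positions (n + 1) - D"
      using elbow_triangle[OF assms(1)] by blast
    have by': "b < y" using b(2) xy by (auto simp: positions_def)
    have "(x, b) \<in> elbow_chords n D" "(b, y) \<in> elbow_chords n D"
      using b by' xy by (auto simp: elbow_chords_def)
    moreover have "b - x < y - x" "y - b < y - x" using b(1) by' by auto
    ultimately obtain l r where "x + size l + 1 = b" "chords x l \<subseteq> elbow_chords n D"
      "b + size r + 1 = y" "chords b r \<subseteq> elbow_chords n D"
      using less.hyps[of b x] less.hyps[of y b] by blast
    then show ?thesis using less.prems by (intro exI[of _ "Node l r"]) (auto simp: add_ac)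
  qed
qed

text \<open>The triangulation below the chord \<open>(1, n + 2)\<close> already has
  \<open>2 * n + 1\<close> chords, and the lower bound on crosses leaves room for no further elbow
  joint.\<close>

lemma elbow_chords_eq_chords:
  assumes "connects n D"
  obtains t where "t \<in> btrees n" "elbow_chords n D = chords 1 t"
proof -
  have D: "D \<subseteq> positions n" using assms by (auto simp: connects_def)
  \<comment> \<open>A cross in the corner would carry strand \<open>1\<close> past column 1, where
    it has to exit.\<close>
  have "(1, 1) \<notin> D"
  proof
    assume cross: "(1, 1) \<in> D"
    then have "1 \<le> n" using D by (auto simp: positions_def)
    then have p2: "(1, 2) \<in> positions (n + 1)" by (auto simp: positions_def)
    have "on_strand (n + 1) D 1 (LeftEdge 1 2)"
    proof (rule row_run[OF on_strand_start])
      fix s :: nat assume "1 \<le> s" "s < 2"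
      then have "s = 1" by simp
      then show "(1, s) \<in> D" using cross by simp
    qed (use \<open>1 \<le> n\<close> in auto)
    then obtain t where "2 \<le> t" "on_strand (n + 1) D 1 (BottomEdge (1 - 1) t)"
      using next_elbow_in_row[OF D _ p2] by metis
    moreover have "on_strand (n + 1) D 1 (BottomEdge 0 (w_perm n 1))"
      using assms by (auto simp: connects_def)
    ultimately show False using exit_unique[of "n + 1" D 1 t 1] by (simp add: w_perm_def)
  qed
  then have "(1, n + 2) \<in> elbow_chords n D" by (auto simp: elbow_chords_def)
  then obtain t where t: "1 + size t + 1 = n + 2" "chords 1 t \<subseteq> elbow_chords n D"
    using elbow_chords_contains_chords[OF assms] by blast
  have "finite (elbow_chords n D)"
    by (rule finite_subset[of _ "{..n + 2} \<times> {..n + 2}"]) (auto simp: elbow_chords_def)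
  moreover have "card (elbow_chords n D) \<le> card (chords 1 t)"
    using card_elbow_chords[OF D] choose_2_le_card_connects[OF assms] choose_2_add_2[of n] t
    by (simp add: card_chords)
  ultimately have "chords 1 t = elbow_chords n D" using t by (intro card_seteq) auto
  then show ?thesis using that t by (auto simp: btrees_def)
qed

section \<open>From triangulations to rc-graphs\<close>

definition triangulation_crosses :: "nat \<Rightarrow> btree \<Rightarrow> (nat \<times> nat) set" where
  "triangulation_crosses n t = {(i, j) \<in> positions (n + 1). (i, n + 3 - j) \<notin> chords 1 t}"

lemma elbow_chords_triangulation:
  assumes "t \<in> btrees n"
  shows "elbow_chords n (triangulation_crosses n t) = chords 1 t"
  using assms chords_range[of _ _ 1 t]
  by (fastforce simp: elbow_chords_def triangulation_crosses_def positions_def btrees_def)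

lemma triangulation_crosses_unique:
  assumes "D \<subseteq> positions n" "elbow_chords n D = chords 1 t"
  shows "D = triangulation_crosses n t"
proof -
  have "(i, j) \<in> D \<longleftrightarrow> (i, n + 3 - j) \<notin> elbow_chords n D" if "(i, j) \<in> positions (n + 1)" for i j
    using that by (auto simp: elbow_chords_def positions_def)
  moreover have "D \<subseteq> positions (n + 1)" using assms by (auto simp: positions_def)
  ultimately show ?thesis using assms(2) by (auto simp: triangulation_crosses_def)
qed

text \<open>The cells of the anti-diagonal are the edges of the polygon, which belong to every
  triangulation.\<close>

lemma triangulation_crosses_subset:
  assumes "t \<in> btrees n"
  shows "triangulation_crosses n t \<subseteq> positions n"
proof -
  have "i + j \<le> n + 1" if "(i, j) \<in> triangulation_crosses n t" for i j
  proof (rule ccontr)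
    assume "\<not> i + j \<le> n + 1"
    with that have "n + 3 - j = Suc i" "1 \<le> i" "i \<le> 1 + size t"
      using assms by (auto simp: triangulation_crosses_def positions_def btrees_def)
    then show False
      using chord_edge[of 1 i t] that by (auto simp: triangulation_crosses_def)
  qed
  then show ?thesis by (auto simp: triangulation_crosses_def positions_def)
qed

lemma corner_not_cross:
  assumes "t \<in> btrees n"
  shows "(1, 1) \<notin> triangulation_crosses n t"
  using chord_top[of 1 t] assms by (auto simp: triangulation_crosses_def btrees_def)

text \<open>The strand entering in row \<open>b\<close> turns exactly at the three sides of the triangle whose middle
  vertex is \<open>b\<close>; it runs straight in between, since an elbow there would be a chord crossing a side.\<close>

lemma triangulation_strand:
  assumes "t \<in> btrees n" "2 \<le> b" "b \<le> n + 1"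
  shows "on_strand (n + 1) (triangulation_crosses n t) b (BottomEdge 0 (n + 3 - b))"
proof -
  let ?D = "triangulation_crosses n t"
  have sz: "size t = n" using assms by (simp add: btrees_def)
  obtain x y where xby: "x < b" "b < y" and
    xb: "(x, b) \<in> chords 1 t" and by': "(b, y) \<in> chords 1 t" and xy: "(x, y) \<in> chords 1 t"
    using chords_triangle[of 1 b t] assms sz by auto
  have r: "1 \<le> x" "y \<le> n + 2" using chords_range[OF xy] sz by auto
  note nc = chords_noncrossing
  have "on_strand (n + 1) ?D b (LeftEdge b (n + 3 - y))"
  proof (rule row_run[OF on_strand_start])
    fix s assume "1 \<le> s" "s < n + 3 - y"
    then show "(b, s) \<in> ?D"
      using nc[OF xy, of b "n + 3 - s"] xby r assms
      by (auto simp: triangulation_crosses_def positions_def)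
  qed (use xby r assms in auto)
  moreover have "(b, n + 3 - y) \<in> positions (n + 1)" "(b, n + 3 - y) \<notin> ?D"
    using xby r by' by (auto simp: positions_def triangulation_crosses_def)
  ultimately have "on_strand (n + 1) ?D b (BottomEdge (b - 1) (n + 3 - y))" by (rule turn_up)
  then have "on_strand (n + 1) ?D b (BottomEdge x (n + 3 - y))"
  proof (rule column_run)
    fix s assume "x < s" "s \<le> b - 1"
    then show "(s, n + 3 - y) \<in> ?D"
      using nc[OF xb, of s y] xby r assms
      by (auto simp: triangulation_crosses_def positions_def)
  qed (use xby r assms in auto)
  moreover have "(x, n + 3 - y) \<in> positions (n + 1)" "(x, n + 3 - y) \<notin> ?D"
    using xby r xy by (auto simp: positions_def triangulation_crosses_def)
  ultimately have "on_strand (n + 1) ?D b (LeftEdge x (n + 3 - y + 1))" by (rule turn_right)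
  then have "on_strand (n + 1) ?D b (LeftEdge x (n + 3 - b))"
  proof (rule row_run)
    fix s assume "n + 3 - y + 1 \<le> s" "s < n + 3 - b"
    then show "(x, s) \<in> ?D"
      using nc[OF _ by', of x "n + 3 - s"] xby r assms
      by (auto simp: triangulation_crosses_def positions_def)
  qed (use xby r assms in auto)
  moreover have "(x, n + 3 - b) \<in> positions (n + 1)" "(x, n + 3 - b) \<notin> ?D"
    using xby r xb by (auto simp: positions_def triangulation_crosses_def)
  ultimately have "on_strand (n + 1) ?D b (BottomEdge (x - 1) (n + 3 - b))" by (rule turn_up)
  then show ?thesis
  proof (rule column_run)
    fix s assume "0 < s" "s \<le> x - 1"
    then show "(s, n + 3 - b) \<in> ?D"
      using nc[OF _ xy, of s b] xby r assms
      by (auto simp: triangulation_crosses_def positions_def)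
  qed (use xby r assms in auto)
qed

lemma connects_triangulation:
  assumes "t \<in> btrees n"
  shows "connects n (triangulation_crosses n t)"
proof -
  have "on_strand (n + 1) (triangulation_crosses n t) 1 (BottomEdge (1 - 1) 1)"
    by (rule turn_up[OF on_strand_start _ corner_not_cross[OF assms]]) (auto simp: positions_def)
  then have "on_strand (n + 1) (triangulation_crosses n t) b (BottomEdge 0 (w_perm n b))"
    if "1 \<le> b" "b \<le> n + 1" for b
    using triangulation_strand[OF assms, of b] that by (cases "b = 1") (auto simp: w_perm_def)
  then show ?thesis using triangulation_crosses_subset[OF assms] by (auto simp: connects_def)
qed

text \<open>The elbow joint in the corner sends strand \<open>1\<close> out at the top of column 1
  at once.\<close>

lemma first_strand_no_crossing:
  assumes "(1, 1) \<notin> D" "D \<subseteq> positions n"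
  shows "crossings m D 1 r = {}"
proof -
  have "e = LeftEdge 1 1 \<or> e = BottomEdge 0 1" if "on_strand m D 1 e" for e
    using that
    by (induction rule: on_strand_induct)
      (use assms in \<open>auto simp: strand_step_from positions_def\<close>)
  then show ?thesis using assms by (fastforce simp: crossings_def positions_def)
qed

text \<open>There are exactly as many crosses as inverted pairs and each such pair uses at least
  one, so none uses two. Strand \<open>1\<close> crosses no other strand.\<close>

lemma triangulation_crosses_rc_graph:
  assumes "t \<in> btrees n"
  shows "triangulation_crosses n t \<in> rc_graphs (n + 1) (w_perm n)"
proof -
  let ?D = "triangulation_crosses n t"
  let ?c = "\<lambda>p r. card (crossings (n + 1) ?D p r)"
  note conn = connects_triangulation[OF assms]
  have "card ?D = n choose 2"
    using card_elbow_chords[OF triangulation_crosses_subset[OF assms]] choose_2_add_2[of n]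
      elbow_chords_triangulation[OF assms] assms
    by (simp add: card_chords btrees_def)
  then have le: "(\<Sum>(p, r)\<in>strand_pairs n. ?c p r) \<le> (\<Sum>(p, r)\<in>strand_pairs n. 1)"
    using sum_card_crossings_le[OF connects_finite[OF conn]] by (simp add: card_strand_pairs)
  have pair: "?c p r \<le> 1" if "(p, r) \<in> strand_pairs n" for p r
  proof (rule ccontr)
    assume "\<not> ?c p r \<le> 1"
    then have "(\<Sum>(p, r)\<in>strand_pairs n. 1) < (\<Sum>(p, r)\<in>strand_pairs n. ?c p r)"
      using that card_crossings_pos[OF conn]
      by (intro sum_strict_mono_ex1) (auto simp: finite_strand_pairs intro!: bexI[of _ "(p, r)"])
    then show False using le by simp
  qed
  have comm: "crossings (n + 1) ?D p r = crossings (n + 1) ?D r p" for p r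
    by (auto simp: crossings_def)
  have "?c p r \<le> 1" if "p \<in> {1..n + 1}" "r \<in> {1..n + 1}" "p \<noteq> r" for p r
  proof -
    consider "p = 1" | "r = 1" | "(p, r) \<in> strand_pairs n" | "(r, p) \<in> strand_pairs n"
    proof (cases "p = 1 \<or> r = 1")
      case False
      then have "2 \<le> p" "2 \<le> r" "p < r \<or> r < p" using \<open>p \<in> _\<close> \<open>r \<in> _\<close> \<open>p \<noteq> r\<close> by auto
      then show ?thesis
        using that(3,4) \<open>p \<in> _\<close> \<open>r \<in> _\<close> by (auto simp: strand_pairs_def)
    qed (use that(1,2) in blast)
    then show ?thesis
    proof cases
      case 2
      have "crossings (n + 1) ?D p 1 = {}"
        unfolding comm[of p] by (rule first_strand_no_crossing[OF corner_not_cross triangulation_crosses_subset, OF assms assms])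
      then show ?thesis using 2 by simp
    next
      case 4
      then show ?thesis using pair comm by metis
    qed (use first_strand_no_crossing[OF corner_not_cross triangulation_crosses_subset, OF assms assms] pair in auto)
  qed
  then show ?thesis using conn by (simp add: rc_graphs_iff del: One_nat_def)
qed

section \<open>The bijection and the weight of a triangulation\<close>

lemma bij_betw_triangulation_crosses:
  "bij_betw (triangulation_crosses n) (btrees n) (rc_graphs (n + 1) (w_perm n))"
proof -
  have "inj_on (triangulation_crosses n) (btrees n)"
    by (rule inj_onI) (metis elbow_chords_triangulation chords_inject)
  moreover have "D \<in> triangulation_crosses n ` btrees n" if "D \<in> rc_graphs (n + 1) (w_perm n)" for D
  proof -
    have "connects n D" using that unfolding rc_graphs_iff ..
    then show ?thesis
      using elbow_chords_eq_chords triangulation_crosses_unique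
      by (metis connects_def image_eqI)
  qed
  ultimately show ?thesis
    using triangulation_crosses_rc_graph by (auto simp: bij_betw_def)
qed

text \<open>All cells together weigh \<open>(n + 2) choose 3\<close>, that is
  \<open>(n choose 3) + n ^ 2\<close>, and the chords take away
  \<open>n ^ 2 - left_weight t\<close>.\<close>

lemma sum_triangulation_crosses:
  assumes "t \<in> btrees n"
  shows "(\<Sum>(i, j)\<in>triangulation_crosses n t. i - 1) = (n choose 3) + left_weight t"
proof -
  have sz: "size t = n" using assms by (simp add: btrees_def)
  \<comment> \<open>Chords of \<open>t\<close> have \<open>x \<ge> 1\<close>, so
    \<open>x - 1\<close> is not truncated.\<close>
  have "(\<Sum>(x, y)\<in>chords 1 t. x - 1) + card (chords 1 t) = (\<Sum>(x, y)\<in>chords 1 t. (x - 1) + 1)"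
    by (simp add: split_beta sum.distrib flip: One_nat_def)
  also have "\<dots> = (\<Sum>(x, y)\<in>chords 1 t. x)"
    using chords_range[of _ _ 1 t] by (intro sum.cong) fastforce+
  finally have 1: "(\<Sum>(x, y)\<in>chords 1 t. x - 1) + left_weight t = n ^ 2"
    using sum_chords[of 1 t] card_chords[of 1 t] sz by simp
  have 2: "(\<Sum>(x, y)\<in>chords 1 t. x - 1) + (\<Sum>(i, j)\<in>triangulation_crosses n t. i - 1)
      = (n + 2) choose 3"
    using sum_elbow_chords[OF triangulation_crosses_subset[OF assms], of "\<lambda>i. i - 1"]
      elbow_chords_triangulation[OF assms] sum_positions[of "n + 1"] by simp
  have "(n + 2) choose 3 = (n choose 3) + 2 * (n choose 2) + n"
    by (simp add: numeral_2_eq_2 numeral_3_eq_3)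
  moreover have "2 * (n choose 2) + n = n ^ 2"
    by (cases n) (auto simp: choose_two power2_eq_square algebra_simps)
  ultimately show ?thesis using 1 2 by linarith
qed

section \<open>Substitution into monomials\<close>

definition monom_subst :: "(nat \<Rightarrow> 'a::comm_ring_1) \<Rightarrow> (nat \<Rightarrow>\<^sub>0 nat) \<Rightarrow> 'a" where
  "monom_subst f a = (\<Prod>i\<in>Poly_Mapping.keys a. f i ^ Poly_Mapping.lookup a i)"

lemma monom_subst_superset:
  assumes "finite S" "Poly_Mapping.keys a \<subseteq> S"
  shows "monom_subst f a = (\<Prod>i\<in>S. f i ^ Poly_Mapping.lookup a i)"
  unfolding monom_subst_def using assms
  by (intro prod.mono_neutral_left) (auto simp: in_keys_iff)

lemma monom_subst_add: "monom_subst f (a + b) = monom_subst f a * monom_subst f b"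
proof -
  let ?S = "Poly_Mapping.keys a \<union> Poly_Mapping.keys b"
  have "Poly_Mapping.keys (a + b) \<subseteq> ?S" by (rule Poly_Mapping.keys_add)
  then show ?thesis
    by (simp add: monom_subst_superset[of ?S] lookup_add power_add prod.distrib)
qed

text \<open>Coefficients may cancel in a sum of polynomials; a common superset of the keys makes the
  sums comparable.\<close>

lemma mpoly_subst_superset:
  assumes "finite S" "Poly_Mapping.keys p \<subseteq> S"
  shows "mpoly_subst f p = (\<Sum>a\<in>S. of_int (Poly_Mapping.lookup p a) * monom_subst f a)"
  unfolding mpoly_subst_def monom_subst_def[symmetric] using assms
  by (intro sum.mono_neutral_left) (auto simp: in_keys_iff)

lemma mpoly_subst_add: "mpoly_subst f (p + q) = mpoly_subst f p + mpoly_subst f q"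
proof -
  let ?S = "Poly_Mapping.keys p \<union> Poly_Mapping.keys q"
  have "Poly_Mapping.keys (p + q) \<subseteq> ?S" by (rule Poly_Mapping.keys_add)
  then show ?thesis
    by (simp add: mpoly_subst_superset[of ?S] lookup_add distrib_right sum.distrib)
qed

lemma mpoly_subst_sum: "mpoly_subst f (\<Sum>x\<in>A. p x) = (\<Sum>x\<in>A. mpoly_subst f (p x))"
  by (induction A rule: infinite_finite_induct) (auto simp: mpoly_subst_add, auto simp: mpoly_subst_def)

lemma mpoly_subst_single: "mpoly_subst f (Poly_Mapping.single a 1) = monom_subst f a"
  by (simp add: mpoly_subst_def monom_subst_def)

text \<open>A product of variables is a single monomial with coefficient 1, so the claim reduces to
  the multiplicativity of \<open>monom_subst\<close>.\<close>

lemma mpoly_subst_prod_mvar: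
  assumes "finite D"
  shows "mpoly_subst f (\<Prod>(i, j)\<in>D. mvar i) = (\<Prod>(i, j)\<in>D. f i)"
proof -
  have "\<exists>a. (\<Prod>(i, j)\<in>D. mvar i) = Poly_Mapping.single a 1 \<and> monom_subst f a = (\<Prod>(i, j)\<in>D. f i)"
    using assms
  proof (induction D)
    case empty
    then show ?case by (intro exI[of _ 0]) (auto simp: monom_subst_def)
  next
    case (insert c D)
    then obtain a where "(\<Prod>(i, j)\<in>D. mvar i) = Poly_Mapping.single a 1"
      "monom_subst f a = (\<Prod>(i, j)\<in>D. f i)" by blast
    moreover have "monom_subst f (Poly_Mapping.single i 1) = f i" for i
      by (simp add: monom_subst_def)
    ultimately show ?case
      using insert.hyps
      by (intro exI[of _ "Poly_Mapping.single (fst c) 1 + a"])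
        (simp add: mvar_def mult_single monom_subst_add split_beta)
  qed
  then show ?thesis using mpoly_subst_single by metis
qed

lemma prod_monom_one: "(\<Prod>x\<in>A. monom (1::int) (g x)) = monom 1 (\<Sum>x\<in>A. g x)"
  by (induction A rule: infinite_finite_induct) (auto simp: mult_monom)

theorem proposition1:
  fixes n :: nat
  assumes "n \<ge> 1"
  shows "mpoly_subst (\<lambda>i. monom 1 (i - 1)) (schubert (n + 1) (w_perm n))
           = monom 1 (n choose 3) * qcatalan n"
proof -
  have "mpoly_subst (\<lambda>i. monom 1 (i - 1)) (schubert (n + 1) (w_perm n))
      = (\<Sum>D\<in>rc_graphs (n + 1) (w_perm n). \<Prod>(i, j)\<in>D. monom (1::int) (i - 1))"
    unfolding schubert_def mpoly_subst_sum
    by (intro sum.cong refl mpoly_subst_prod_mvar finite_rc_graph)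
  also have "\<dots> = (\<Sum>D\<in>rc_graphs (n + 1) (w_perm n). monom 1 (\<Sum>(i, j)\<in>D. i - 1))"
    by (simp add: split_beta prod_monom_one)
  also have "\<dots> = (\<Sum>t\<in>btrees n. monom 1 (\<Sum>(i, j)\<in>triangulation_crosses n t. i - 1))"
    by (rule sum.reindex_bij_betw[OF bij_betw_triangulation_crosses, symmetric])
  also have "\<dots> = (\<Sum>t\<in>btrees n. monom 1 (n choose 3) * monom 1 (left_weight t))"
    by (intro sum.cong refl) (simp add: sum_triangulation_crosses mult_monom del: One_nat_def)
  also have "\<dots> = monom 1 (n choose 3) * qcatalan n"
    by (simp add: qcatalan_btrees sum_distrib_left)
  finally show ?thesis .
qed

end
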